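(* For every $\alpha\in\mathbb{R}_{\ge1}\cup\{\infty\}$ there exists a factorizable Boolean sublattice $S$ with elasticity $\rho(S)=\alpha$.
   Context: Let $B_{\mathbb{N}}$ be the set of all finite subsets of $\mathbb{N}=\{1,2,3,\dots\}$, ordered by inclusion. A Boolean sublattice is a subset $S\subseteq B_{\mathbb{N}}$ containing $\emptyset$ and closed under finite unions. A quark of $S$ is a nonempty $A\in S$ such that no $B\in S$ satisfies $\emptyset\subsetneq B\subsetneq A$; $\mathcal{A}(S)$ is the set of quarks. $S$ is factorizable if every nonempty element is a union of finitely many quarks. For nonempty $X\in S$, a factorization of $X$ in $S$ is a finite set $z\subseteq\mathcal{A}(S)$ with $\bigcup z=X$ and $\bigcup z'\subsetneq X$ for every proper subset $z'\subsetneq z$; $\mathsf{L}(X)$ is the set of sizes of factorizations of $X$. For a factorizable $S$ with $|S|\ge 2$ and nonempty $X\in S$, the elasticity of $X$ is $\rho(X)=\sup\mathsf{L}(X)/\min\mathsf{L}(X)$, and the elasticity of $S$ is $\rho(S)=\sup\{\rho(X)\mid X\in S\setminus\{\emptyset\}\}$. *)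

theory Defs
  imports Complex_Main "HOL-Library.Extended_Real"
begin

definition B_N :: "nat set set" where
  "B_N = {A. finite A \<and> A \<subseteq> {1..}}"

definition boolean_sublattice :: "nat set set \<Rightarrow> bool" where
  "boolean_sublattice S \<longleftrightarrow>
     S \<subseteq> B_N \<and> {} \<in> S \<and> (\<forall>A\<in>S. \<forall>B\<in>S. A \<union> B \<in> S)"

definition quarks :: "nat set set \<Rightarrow> nat set set" where
  "quarks S = {A \<in> S. A \<noteq> {} \<and> \<not> (\<exists>B\<in>S. {} \<subset> B \<and> B \<subset> A)}"

definition factorizable :: "nat set set \<Rightarrow> bool" where
  "factorizable S \<longleftrightarrow>
     (\<forall>X\<in>S. X \<noteq> {} \<longrightarrow> (\<exists>z. finite z \<and> z \<subseteq> quarks S \<and> \<Union>z = X))"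

definition factorizations :: "nat set set \<Rightarrow> nat set \<Rightarrow> nat set set set" where
  "factorizations S X =
     {z. finite z \<and> z \<subseteq> quarks S \<and> \<Union>z = X \<and> (\<forall>z'. z' \<subset> z \<longrightarrow> \<Union>z' \<subset> X)}"

definition length_set :: "nat set set \<Rightarrow> nat set \<Rightarrow> nat set" where
  "length_set S X = card ` factorizations S X"

text \<open>
  The infimum in the denominator is taken in \<^typ>\<open>nat\<close>, so it is the minimum of the
  length set whenever that set is nonempty, as is the case for every nonempty element
  of a factorizable sublattice.
\<close>
definition elasticity_elem :: "nat set set \<Rightarrow> nat set \<Rightarrow> ereal" where
  "elasticity_elem S X =
     (SUP n\<in>length_set S X. ereal (real n)) / ereal (real (Inf (length_set S X)))"

definition elasticity :: "nat set set \<Rightarrow> ereal" where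
  "elasticity S = (SUP X\<in>S - {{}}. elasticity_elem S X)"

end

theory Submission
  imports Defs "HOL-Library.Nat_Bijection"
begin

text \<open>
  The rows and columns of a \<open>q \<times> p\<close> grid (with \<open>p, q \<ge> 2\<close>) form an antichain. The whole grid
  is irredundantly covered only by all its rows or by all its columns, while every other union of
  rows and columns has a unique irredundant cover: if the cell \<open>(j', i')\<close> is missing, then a row
  \<open>j\<close> inside the union is forced by its cell \<open>(j, i')\<close>, and dually for columns. Hence the
  sublattice generated by infinitely many pairwise disjoint grids of sizes \<open>q k \<times> p k\<close> with
  \<open>q k \<le> p k\<close> has elasticity \<open>sup p k / q k\<close>, and every \<open>\<alpha> \<ge> 1\<close> is such a supremum.
\<close>

section \<open>Sublattices generated by an antichain\<close>

definition union_closure :: "nat set set \<Rightarrow> nat set set" where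
  "union_closure Q = Union ` {z. finite z \<and> z \<subseteq> Q}"

lemma boolean_sublattice_union_closure:
  assumes "Q \<subseteq> B_N"
  shows "boolean_sublattice (union_closure Q)"
  unfolding boolean_sublattice_def
proof (intro conjI ballI)
  show "union_closure Q \<subseteq> B_N"
    using assms by (fastforce simp: union_closure_def B_N_def)
  show "{} \<in> union_closure Q"
    by (force simp: union_closure_def)
  fix A B assume "A \<in> union_closure Q" "B \<in> union_closure Q"
  then obtain z w where "finite z" "z \<subseteq> Q" "A = \<Union>z" "finite w" "w \<subseteq> Q" "B = \<Union>w"
    by (auto simp: union_closure_def)
  then have "finite (z \<union> w)" "z \<union> w \<subseteq> Q" "A \<union> B = \<Union>(z \<union> w)"
    by auto
  then show "A \<union> B \<in> union_closure Q"
    unfolding union_closure_def by blast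
qed

text \<open>Every nonempty finite union contains a member of \<open>Q\<close>, so a minimal one is
  itself in \<open>Q\<close>. Conversely, a nonempty union properly inside some \<open>A\<close> in
  \<open>Q\<close> would contain a member of \<open>Q\<close> properly below \<open>A\<close>,
  against the antichain condition.\<close>

lemma quarks_union_closure:
  assumes "{} \<notin> Q" and antichain: "\<And>A B. A \<in> Q \<Longrightarrow> B \<in> Q \<Longrightarrow> A \<subseteq> B \<Longrightarrow> A = B"
  shows "quarks (union_closure Q) = Q"
proof
  have sub: "Q \<subseteq> union_closure Q"
  proof
    fix A assume "A \<in> Q"
    then have "finite {A}" "{A} \<subseteq> Q" "A = \<Union>{A}"
      by auto
    then show "A \<in> union_closure Q"
      unfolding union_closure_def by blast
  qed
  have below: "\<exists>A\<in>Q. A \<subseteq> X" if "X \<in> union_closure Q" "X \<noteq> {}" for X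
    using that by (auto simp: union_closure_def)
  show "quarks (union_closure Q) \<subseteq> Q"
  proof
    fix X assume X: "X \<in> quarks (union_closure Q)"
    then obtain A where A: "A \<in> Q" "A \<subseteq> X"
      using below[of X] unfolding quarks_def by blast
    then have "A \<noteq> {}" "A \<in> union_closure Q"
      using sub assms(1) by auto
    then have "A = X"
      using X A(2) unfolding quarks_def by blast
    then show "X \<in> Q"
      using A by simp
  qed
  show "Q \<subseteq> quarks (union_closure Q)"
  proof
    fix A assume A: "A \<in> Q"
    have "\<not> B \<subset> A" if "B \<in> union_closure Q" "{} \<subset> B" for B
      using below[of B] antichain[OF _ A] that by blast
    then show "A \<in> quarks (union_closure Q)"
      using A sub assms(1) unfolding quarks_def by blast
  qed
qed

lemma factorizable_union_closure:
  assumes "{} \<notin> Q" "\<And>A B. A \<in> Q \<Longrightarrow> B \<in> Q \<Longrightarrow> A \<subseteq> B \<Longrightarrow> A = B"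
  shows "factorizable (union_closure Q)"
proof -
  have "quarks (union_closure Q) = Q"
    using assms by (rule quarks_union_closure)
  then show ?thesis
    by (auto simp: factorizable_def union_closure_def)
qed

section \<open>Elasticity bounds from pairs of lengths\<close>

lemma length_set_pos:
  assumes "n \<in> length_set S X" "X \<noteq> {}"
  shows "0 < n"
  using assms by (auto simp: length_set_def factorizations_def card_gt_0_iff)

text \<open>Comparing arbitrary pairs of lengths avoids computing extrema: take \<open>m\<close> to
  be the minimum and let \<open>n\<close> run through the supremum.\<close>

lemma elasticity_elem_le:
  fixes a :: real
  assumes "X \<noteq> {}"
    and le: "\<And>m n. m \<in> length_set S X \<Longrightarrow> n \<in> length_set S X \<Longrightarrow> real n \<le> a * real m"
  shows "elasticity_elem S X \<le> ereal a"
proof (cases "length_set S X = {}")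
  \<comment> \<open>The supremum over the empty set is -\<infinity>, and so is its quotient by any
    natural number in \<open>ereal\<close>.\<close>
  case True
  then show ?thesis
    by (simp add: elasticity_elem_def bot_ereal_def)
next
  case False
  define m where "m = Inf (length_set S X)"
  have m: "m \<in> length_set S X"
    using False unfolding m_def by (rule Inf_nat_def1)
  then have "0 < m"
    using assms(1) by (rule length_set_pos)
  have "(SUP n\<in>length_set S X. ereal (real n)) \<le> ereal a * ereal (real m)"
    using le[OF m] by (auto intro!: SUP_least)
  then show ?thesis
    using \<open>0 < m\<close> unfolding elasticity_elem_def m_def[symmetric]
    by (subst ereal_divide_le_pos) (auto simp: mult.commute)
qed

text \<open>Replacing \<open>m\<close> by the minimal length and \<open>n\<close> by the supremum
  can only enlarge the ratio.\<close>

lemma elasticity_elem_ge: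
  assumes "X \<noteq> {}" "m \<in> length_set S X" "n \<in> length_set S X"
  shows "ereal (real n / real m) \<le> elasticity_elem S X"
proof -
  define l where "l = Inf (length_set S X)"
  have "l \<in> length_set S X"
    using assms(2) unfolding l_def by (intro Inf_nat_def1) auto
  then have "0 < l"
    using assms(1) by (rule length_set_pos)
  have "l \<le> m"
    using assms(2) unfolding l_def by (rule wellorder_Inf_le1)
  have "ereal (real n / real m) \<le> ereal (real n) / ereal (real l)"
    using \<open>0 < l\<close> \<open>l \<le> m\<close> by (simp add: frac_le)
  also have "\<dots> \<le> elasticity_elem S X"
    unfolding elasticity_elem_def l_def[symmetric] using \<open>0 < l\<close> assms(3)
    by (intro ereal_divide_right_mono SUP_upper) auto
  finally show ?thesis .
qed

section \<open>Grids of positive integers and their lines\<close>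

text \<open>Grid number, row and column are encoded injectively, so distinct grids are disjoint. The
  successor avoids 0, which is excluded from the ground set of \<open>B_N\<close>.\<close>

definition cell :: "nat \<Rightarrow> nat \<Rightarrow> nat \<Rightarrow> nat" where
  "cell k j i = Suc (prod_encode (k, prod_encode (j, i)))"

lemma cell_eq_iff [simp]: "cell k j i = cell k' j' i' \<longleftrightarrow> k = k' \<and> j = j' \<and> i = i'"
  by (auto simp: cell_def)

lemma cell_ge_1: "1 \<le> cell k j i"
  by (simp add: cell_def)

text \<open>Grid \<open>k\<close> has \<open>q k\<close> rows and \<open>p k\<close> columns. The
  bound 2 makes rows and columns incomparable: a single row would contain every column. The order of
  \<open>q k\<close> and \<open>p k\<close> makes the columns the longer factorization.\<close>

locale disjoint_grids =
  fixes p q :: "nat \<Rightarrow> nat"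
  assumes q_ge_2: "2 \<le> q k" and q_le_p: "q k \<le> p k"
begin

definition row :: "nat \<Rightarrow> nat \<Rightarrow> nat set" where
  "row k j = cell k j ` {..<p k}"

definition col :: "nat \<Rightarrow> nat \<Rightarrow> nat set" where
  "col k i = (\<lambda>j. cell k j i) ` {..<q k}"

definition rows :: "nat \<Rightarrow> nat set set" where
  "rows k = row k ` {..<q k}"

definition cols :: "nat \<Rightarrow> nat set set" where
  "cols k = col k ` {..<p k}"

definition lines :: "nat \<Rightarrow> nat set set" where
  "lines k = rows k \<union> cols k"

definition grid :: "nat \<Rightarrow> nat set" where
  "grid k = {cell k j i |j i. j < q k \<and> i < p k}"

definition lattice :: "nat set set" where
  "lattice = union_closure (\<Union>k. lines k)"

lemma p_ge_2: "2 \<le> p k"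
  using q_ge_2 q_le_p le_trans by blast

lemma pq_pos: "0 < p k" "0 < q k"
  using p_ge_2[of k] q_ge_2[of k] by auto

lemma cell_in_row [simp]: "cell k j i \<in> row k' j' \<longleftrightarrow> k = k' \<and> j = j' \<and> i < p k"
  by (auto simp: row_def)

lemma cell_in_col [simp]: "cell k j i \<in> col k' i' \<longleftrightarrow> k = k' \<and> i = i' \<and> j < q k"
  by (auto simp: col_def)

lemma Union_rows: "\<Union>(rows k) = grid k"
  by (auto simp: rows_def row_def grid_def)

lemma Union_cols: "\<Union>(cols k) = grid k"
  by (auto simp: cols_def col_def grid_def)

lemma line_subset_grid: "A \<in> lines k \<Longrightarrow> A \<subseteq> grid k"
  using Union_rows Union_cols unfolding lines_def by blast

lemma grid_disjoint: "k \<noteq> l \<Longrightarrow> grid k \<inter> grid l = {}"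
  by (auto simp: grid_def)

lemma grid_nonempty: "grid k \<noteq> {}"
  using pq_pos by (auto simp: grid_def)

lemma line_nonempty: "A \<in> lines k \<Longrightarrow> A \<noteq> {}"
  using pq_pos[of k] by (auto simp: lines_def rows_def cols_def row_def col_def)

text \<open>A nonempty set cannot lie in two disjoint grids. With \<open>A = B\<close> this also
  says that the families \<open>lines k\<close> are pairwise disjoint, which the blockwise counting
  relies on.\<close>

lemma line_subset_line_block:
  assumes "A \<in> lines k" "B \<in> lines l" "A \<subseteq> B"
  shows "k = l"
proof (rule ccontr)
  assume "k \<noteq> l"
  then show False
    using line_subset_grid[OF assms(1)] line_subset_grid[OF assms(2)] line_nonempty[OF assms(1)]
      grid_disjoint[of k l] assms(3) by blast
qed

lemma line_finite: "A \<in> lines k \<Longrightarrow> finite A"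
  by (auto simp: lines_def rows_def cols_def row_def col_def)

lemma finite_rows: "finite (rows k)" and finite_cols: "finite (cols k)"
  by (auto simp: rows_def cols_def)

lemma row_inj: "row k j = row k j' \<Longrightarrow> j = j'"
  using cell_in_row[of k j 0 k j'] cell_in_row[of k j 0 k j] pq_pos by auto

lemma col_inj: "col k i = col k i' \<Longrightarrow> i = i'"
  using cell_in_col[of k 0 i k i'] cell_in_col[of k 0 i k i] pq_pos by auto

lemma card_rows: "card (rows k) = q k"
  unfolding rows_def by (subst card_image) (auto intro: inj_onI dest: row_inj)

lemma card_cols: "card (cols k) = p k"
  unfolding cols_def by (subst card_image) (auto intro: inj_onI dest: col_inj)

lemma row_subset_row: "row k j \<subseteq> row k j' \<Longrightarrow> j = j'"
  using pq_pos[of k] cell_in_row[of k j 0 k j] cell_in_row[of k j 0 k j'] by blast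

lemma col_subset_col: "col k i \<subseteq> col k i' \<Longrightarrow> i = i'"
  using pq_pos[of k] cell_in_col[of k 0 i k i] cell_in_col[of k 0 i k i'] by blast

text \<open>A row has two cells in different columns, since there are at least two columns.\<close>

lemma not_row_subset_col: "\<not> row k j \<subseteq> col k i"
proof
  assume "row k j \<subseteq> col k i"
  moreover have "cell k j 0 \<in> row k j" "cell k j 1 \<in> row k j"
    using p_ge_2[of k] by auto
  ultimately have "cell k j 0 \<in> col k i" "cell k j 1 \<in> col k i"
    by blast+
  then show False
    by simp
qed

lemma not_col_subset_row: "\<not> col k i \<subseteq> row k j"
proof
  assume "col k i \<subseteq> row k j"
  moreover have "cell k 0 i \<in> col k i" "cell k 1 i \<in> col k i"
    using q_ge_2[of k] by auto
  ultimately have "cell k 0 i \<in> row k j" "cell k 1 i \<in> row k j"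
    by blast+
  then show False
    by simp
qed

lemma lines_antichain:
  assumes "A \<in> (\<Union>k. lines k)" "B \<in> (\<Union>k. lines k)" "A \<subseteq> B"
  shows "A = B"
proof -
  obtain k l where kl: "A \<in> lines k" "B \<in> lines l"
    using assms by blast
  then have "k = l"
    using assms(3) by (rule line_subset_line_block)
  then show ?thesis
    using kl assms(3) not_row_subset_col not_col_subset_row
    by (auto simp: lines_def rows_def cols_def dest: row_subset_row col_subset_col)
qed

lemma empty_not_line: "{} \<notin> (\<Union>k. lines k)"
  using line_nonempty by blast

lemma quarks_lattice: "quarks lattice = (\<Union>k. lines k)"
  unfolding lattice_def using empty_not_line lines_antichain by (rule quarks_union_closure)

lemma factorizable_lattice: "factorizable lattice"
  unfolding lattice_def using empty_not_line lines_antichain by (rule factorizable_union_closure)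

lemma boolean_sublattice_lattice: "boolean_sublattice lattice"
proof -
  have "x \<ge> 1" if "x \<in> A" "A \<in> lines k" for x A k
    using line_subset_grid[OF that(2)] that(1) cell_ge_1 by (auto simp: grid_def)
  then show ?thesis
    unfolding lattice_def using line_finite
    by (intro boolean_sublattice_union_closure) (auto simp: B_N_def)
qed

section \<open>Factorizations of unions of lines\<close>

text \<open>Distinct rows are disjoint, so omitting row \<open>j\<close> uncovers its cell in column
  0.\<close>

lemma factorization_grid_rows: "rows k \<in> factorizations lattice (grid k)"
proof -
  have "\<Union>z' \<subset> grid k" if z': "z' \<subset> rows k" for z'
  proof -
    obtain j where j: "j < q k" "row k j \<notin> z'"
      using z' by (auto simp: rows_def)
    have "cell k j 0 \<notin> \<Union>z'"
      using z' j by (auto simp: rows_def)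
    moreover have "cell k j 0 \<in> grid k"
      using j pq_pos by (auto simp: grid_def)
    moreover have "\<Union>z' \<subseteq> grid k"
      using z' Union_rows by blast
    ultimately show ?thesis
      by blast
  qed
  then show ?thesis
    using finite_rows Union_rows by (auto simp: factorizations_def quarks_lattice lines_def)
qed

lemma factorization_grid_cols: "cols k \<in> factorizations lattice (grid k)"
proof -
  have "\<Union>z' \<subset> grid k" if z': "z' \<subset> cols k" for z'
  proof -
    obtain i where i: "i < p k" "col k i \<notin> z'"
      using z' by (auto simp: cols_def)
    have "cell k 0 i \<notin> \<Union>z'"
      using z' i by (auto simp: cols_def)
    moreover have "cell k 0 i \<in> grid k"
      using i pq_pos by (auto simp: grid_def)
    moreover have "\<Union>z' \<subseteq> grid k"
      using z' Union_cols by blast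
    ultimately show ?thesis
      by blast
  qed
  then show ?thesis
    using finite_cols Union_cols by (auto simp: factorizations_def quarks_lattice lines_def)
qed

text \<open>Only two lines pass through a cell of a grid. Hence, once one of them is excluded from
  \<open>z\<close>, the other is forced; the classification of factorizations rests on this.\<close>

lemma cell_covered:
  assumes "z \<subseteq> (\<Union>k. lines k)" "cell k j i \<in> \<Union>z"
  shows "row k j \<in> z \<or> col k i \<in> z"
proof -
  obtain A l where A: "A \<in> z" "A \<in> lines l" "cell k j i \<in> A"
    using assms by blast
  then show ?thesis
    by (auto simp: lines_def rows_def cols_def)
qed

text \<open>The right-hand side depends on \<open>X\<close> alone, so all factorizations of
  \<open>X\<close> agree on a grid that is not contained in \<open>X\<close>.\<close>

lemma factorization_inter_lines_partial:
  assumes z: "z \<in> factorizations lattice X" and "\<not> grid k \<subseteq> X"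
  shows "z \<inter> lines k = {A \<in> lines k. A \<subseteq> X}"
proof
  have zX: "\<Union>z = X" and zl: "z \<subseteq> (\<Union>k. lines k)"
    using z by (auto simp: factorizations_def quarks_lattice)
  show "z \<inter> lines k \<subseteq> {A \<in> lines k. A \<subseteq> X}"
    using zX by blast
  obtain j' i' where miss: "j' < q k" "i' < p k" "cell k j' i' \<notin> X"
    using assms(2) by (auto simp: grid_def)
  show "{A \<in> lines k. A \<subseteq> X} \<subseteq> z \<inter> lines k"
  proof
    fix A assume "A \<in> {A \<in> lines k. A \<subseteq> X}"
    then have A: "A \<in> lines k" "A \<subseteq> X"
      by auto
    then consider j where "A = row k j" | i where "A = col k i"
      by (auto simp: lines_def rows_def cols_def)
    then have "A \<in> z"
    proof cases
      case 1
      then have "cell k j i' \<in> \<Union>z"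
        using A miss zX by auto
      \<comment> \<open>Column \<open>i'\<close> would bring in the missing cell, so only row
        \<open>j\<close> can cover its cell in column \<open>i'\<close>.\<close>
      moreover have "col k i' \<notin> z"
        using miss zX by auto
      ultimately show ?thesis
        using cell_covered[OF zl] 1 by blast
    next
      case 2
      then have "cell k j' i \<in> \<Union>z"
        using A miss zX by auto
      moreover have "row k j' \<notin> z"
        using miss zX by auto
      ultimately show ?thesis
        using cell_covered[OF zl] 2 by blast
    qed
    then show "A \<in> z \<inter> lines k"
      using A by blast
  qed
qed

text \<open>Any further line of grid \<open>k\<close> is already covered by \<open>r\<close>, so
  deleting it from \<open>z\<close> would keep the union, contradicting irredundancy.\<close>

lemma factorization_inter_lines_eq:
  assumes z: "z \<in> factorizations lattice X"
    and r: "r \<subseteq> z" "r \<subseteq> lines k" "\<Union>r = grid k"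
  shows "z \<inter> lines k = r"
proof (rule ccontr)
  assume "z \<inter> lines k \<noteq> r"
  then obtain A where A: "A \<in> z" "A \<in> lines k" "A \<notin> r"
    using r by blast
  then have "A \<subseteq> \<Union>(z - {A})"
    using line_subset_grid[OF A(2)] r by blast
  then have "\<Union>(z - {A}) = \<Union>z"
    by blast
  moreover have "z - {A} \<subset> z"
    using A by blast
  moreover have "\<Union>z = X" "\<And>z'. z' \<subset> z \<Longrightarrow> \<Union>z' \<subset> X"
    using z by (auto simp only: factorizations_def mem_Collect_eq)
  ultimately show False
    by (metis psubsetE order_refl)
qed

text \<open>If a row and a column were both absent from \<open>z\<close>, the cell where they cross
  would be uncovered. So all rows or all columns are present, and irredundancy then excludes other
  lines of the grid.\<close>

lemma factorization_inter_lines_full: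
  assumes z: "z \<in> factorizations lattice X" and "grid k \<subseteq> X"
  shows "z \<inter> lines k = rows k \<or> z \<inter> lines k = cols k"
proof -
  have zX: "\<Union>z = X" and zl: "z \<subseteq> (\<Union>k. lines k)"
    using z by (auto simp: factorizations_def quarks_lattice)
  have "rows k \<subseteq> z \<or> cols k \<subseteq> z"
  proof (rule ccontr)
    assume "\<not> (rows k \<subseteq> z \<or> cols k \<subseteq> z)"
    then obtain j i where ji: "j < q k" "row k j \<notin> z" "i < p k" "col k i \<notin> z"
      by (auto simp: rows_def cols_def)
    then have "cell k j i \<in> \<Union>z"
      using zX assms(2) by (auto simp: grid_def)
    then show False
      using cell_covered[OF zl] ji by blast
  qed
  then show ?thesis
  proof
    assume "rows k \<subseteq> z"
    then have "z \<inter> lines k = rows k"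
      using z Union_rows by (intro factorization_inter_lines_eq) (auto simp only: lines_def)
    then show ?thesis ..
  next
    assume "cols k \<subseteq> z"
    then have "z \<inter> lines k = cols k"
      using z Union_cols by (intro factorization_inter_lines_eq) (auto simp only: lines_def)
    then show ?thesis ..
  qed
qed

section \<open>Comparison of lengths and elasticity of the lattice\<close>

lemma card_eq_sum_lines:
  assumes "finite z" "finite K" "z \<subseteq> (\<Union>k\<in>K. lines k)"
  shows "card z = (\<Sum>k\<in>K. card (z \<inter> lines k))"
proof -
  have "z = (\<Union>k\<in>K. z \<inter> lines k)"
    using assms(3) by blast
  also have "card \<dots> = (\<Sum>k\<in>K. card (z \<inter> lines k))"
    using assms(1,2) line_subset_line_block[OF _ _ order_refl] by (intro card_UN_disjoint) auto
  finally show ?thesis .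
qed

lemma finite_subset_finitely_many_lines:
  assumes "finite z" "z \<subseteq> (\<Union>k. lines k)"
  shows "\<exists>K. finite K \<and> z \<subseteq> (\<Union>k\<in>K. lines k)"
proof -
  obtain f where "\<And>A. A \<in> z \<Longrightarrow> A \<in> lines (f A)"
    using assms(2) by (metis UN_E subsetD)
  then show ?thesis
    using assms(1) by (intro exI[of _ "f ` z"]) auto
qed

text \<open>Lengths are compared grid by grid: the two counts agree on partially covered grids, and
  on full ones each is \<open>q k\<close> or \<open>p k\<close>. Summation preserves the factor
  \<open>a\<close>.\<close>

lemma card_factorization_le:
  fixes a :: real
  assumes z: "z \<in> factorizations lattice X" and w: "w \<in> factorizations lattice X"
    and "1 \<le> a" and pq: "\<And>k. real (p k) \<le> a * real (q k)"
  shows "real (card z) \<le> a * real (card w)"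
proof -
  have fin: "finite z" "finite w" and "z \<union> w \<subseteq> (\<Union>k. lines k)"
    using z w by (auto simp: factorizations_def quarks_lattice)
  \<comment> \<open>Taking \<open>K\<close> for \<open>z \<union> w\<close> lets both lengths be
    summed over the same grids.\<close>
  then obtain K where K: "finite K" "z \<union> w \<subseteq> (\<Union>k\<in>K. lines k)"
    using finite_subset_finitely_many_lines[of "z \<union> w"] by blast
  have a_mult: "real n \<le> a * real n" for n
    using mult_right_mono[OF \<open>1 \<le> a\<close>, of "real n"] by simp
  have block: "real (card (z \<inter> lines k)) \<le> a * real (card (w \<inter> lines k))" for k
  proof (cases "grid k \<subseteq> X")
    case True
    \<comment> \<open>This is the case where \<open>z\<close> uses the rows and \<open>w\<close> the
      columns; equal counts are handled by \<open>a_mult\<close>, the opposite case by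
      \<open>pq\<close>.\<close>
    have "real (q k) \<le> a * real (p k)"
      using q_le_p[of k] a_mult[of "p k"] by linarith
    then show ?thesis
      using factorization_inter_lines_full[OF z True] factorization_inter_lines_full[OF w True]
        a_mult pq[of k] by (auto simp: card_rows card_cols)
  next
    case False
    then show ?thesis
      using factorization_inter_lines_partial[OF z False]
        factorization_inter_lines_partial[OF w False] a_mult by simp
  qed
  have "real (card z) = (\<Sum>k\<in>K. real (card (z \<inter> lines k)))"
    using card_eq_sum_lines[OF fin(1) K(1)] K(2) by simp
  also have "\<dots> \<le> (\<Sum>k\<in>K. a * real (card (w \<inter> lines k)))"
    using block by (intro sum_mono)
  also have "\<dots> = a * real (card w)"
    using card_eq_sum_lines[OF fin(2) K(1)] K(2) by (simp add: sum_distrib_left)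
  finally show ?thesis .
qed

lemma grid_in_lattice: "grid k \<in> lattice - {{}}"
proof -
  have "finite (rows k)" "rows k \<subseteq> (\<Union>k. lines k)" "grid k = \<Union>(rows k)"
    using finite_rows Union_rows by (auto simp: lines_def)
  then show ?thesis
    using grid_nonempty unfolding lattice_def union_closure_def by blast
qed

text \<open>The grids themselves give the lower bound. For the upper bound, a finite supremum serves
  as the factor \<open>a\<close> in \<open>card_factorization_le\<close>.\<close>

lemma elasticity_lattice: "elasticity lattice = (SUP k. ereal (real (p k) / real (q k)))"
proof (rule antisym)
  let ?s = "SUP k. ereal (real (p k) / real (q k))"
  show "?s \<le> elasticity lattice"
  proof (rule SUP_least)
    fix k
    have "q k \<in> length_set lattice (grid k)" "p k \<in> length_set lattice (grid k)"
      using factorization_grid_rows[of k] factorization_grid_cols[of k] card_rows[of k] card_cols[of k]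
      unfolding length_set_def by (metis imageI)+
    then have "ereal (real (p k) / real (q k)) \<le> elasticity_elem lattice (grid k)"
      using grid_nonempty by (intro elasticity_elem_ge)
    also have "\<dots> \<le> elasticity lattice"
      unfolding elasticity_def using grid_in_lattice by (rule SUP_upper)
    finally show "ereal (real (p k) / real (q k)) \<le> elasticity lattice" .
  qed
  have upper: "ereal (real (p k) / real (q k)) \<le> ?s" for k
    by (rule SUP_upper) simp
  \<comment> \<open>A supremum of at least 1 cannot be -\<infinity>, and when finite it satisfies
    the condition \<open>1 \<le> a\<close> on the comparison factor.\<close>
  have "1 \<le> ereal (real (p 0) / real (q 0))"
    using q_le_p[of 0] pq_pos[of 0] by simp
  then have s_ge_1: "1 \<le> ?s"
    using upper[of 0] by (rule order_trans)
  show "elasticity lattice \<le> ?s"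
  proof (cases "?s")
    case (real a)
    have "1 \<le> a"
      using s_ge_1 real by simp
    moreover have "real (p k) \<le> a * real (q k)" for k
      using upper[of k] real pq_pos[of k] by (simp add: field_simps)
    ultimately have "elasticity_elem lattice X \<le> ereal a" if "X \<noteq> {}" for X
      using that card_factorization_le
      by (intro elasticity_elem_le) (auto simp: length_set_def)
    then show ?thesis
      unfolding elasticity_def real by (intro SUP_least) auto
  next
    case PInf
    then show ?thesis
      by simp
  next
    case MInf
    then show ?thesis
      using s_ge_1 by simp
  qed
qed

end

section \<open>Suprema of ratios and the choice of grids\<close>

text \<open>With \<open>n = k + 2\<close>, rounding \<open>a * n\<close> down loses less than 1, so
  the quotient lies between \<open>a - 1 / n\<close> and \<open>a\<close>.\<close>

lemma SUP_floor_mult_div: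
  fixes a :: real
  assumes "1 \<le> a"
  shows "(SUP k. ereal (real (nat \<lfloor>a * real (k + 2)\<rfloor>) / real (k + 2))) = ereal a"
proof (rule SUP_eqI)
  have nat_floor: "real (nat \<lfloor>a * real (k + 2)\<rfloor>) = of_int \<lfloor>a * real (k + 2)\<rfloor>" for k
    using assms by simp
  show "ereal (real (nat \<lfloor>a * real (k + 2)\<rfloor>) / real (k + 2)) \<le> ereal a" for k
    unfolding nat_floor by (simp add: divide_le_eq)
  fix y assume y: "\<And>k. k \<in> UNIV \<Longrightarrow> ereal (real (nat \<lfloor>a * real (k + 2)\<rfloor>) / real (k + 2)) \<le> y"
  have lower: "a - 1 / real (k + 2) \<le> real (nat \<lfloor>a * real (k + 2)\<rfloor>) / real (k + 2)" for k
  proof -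
    have "a * real (k + 2) - 1 \<le> of_int \<lfloor>a * real (k + 2)\<rfloor>"
      by linarith
    then have "(a * real (k + 2) - 1) / real (k + 2) \<le> of_int \<lfloor>a * real (k + 2)\<rfloor> / real (k + 2)"
      by (intro divide_right_mono) auto
    then show ?thesis
      unfolding nat_floor by (simp add: diff_divide_distrib)
  qed
  \<comment> \<open>Each index only yields \<open>a - 1 / (k + 2) \<le> y\<close>; the limit removes
    the error term.\<close>
  have "(\<lambda>k. a - 1 / real (k + 2)) \<longlonglongrightarrow> a - 0"
    by (intro tendsto_diff tendsto_const LIMSEQ_ignore_initial_segment[OF lim_1_over_n])
  then have "(\<lambda>k. ereal (a - 1 / real (k + 2))) \<longlonglongrightarrow> ereal a"
    by simp
  then show "ereal a \<le> y"
  proof (rule LIMSEQ_le_const2, intro exI allI impI)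
    show "ereal (a - 1 / real (k + 2)) \<le> y" for k
      using lower[of k] y[of k] by (meson UNIV_I ereal_less_eq(3) order_trans)
  qed
qed

lemma ereal_eq_SUP_ratio:
  fixes \<alpha> :: ereal
  assumes "1 \<le> \<alpha>"
  shows "\<exists>p q :: nat \<Rightarrow> nat. (\<forall>k. 2 \<le> q k \<and> q k \<le> p k) \<and>
    (SUP k. ereal (real (p k) / real (q k))) = \<alpha>"
proof (cases \<alpha>)
  case (real a)
  then have a: "1 \<le> a"
    using assms by simp
  \<comment> \<open>The integer \<open>k + 2\<close> is at most \<open>a * (k + 2)\<close>, hence at
    most its floor. The shift by 2 keeps every denominator at least 2.\<close>
  have "k + 2 \<le> nat \<lfloor>a * real (k + 2)\<rfloor>" for k
    using mult_right_mono[OF a, of "real (k + 2)"] by (simp add: le_nat_iff le_floor_iff)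
  then show ?thesis
    using SUP_floor_mult_div[OF a] real
    by (intro exI[of _ "\<lambda>k. nat \<lfloor>a * real (k + 2)\<rfloor>"] exI[of _ "\<lambda>k. k + 2"]) simp
next
  case PInf
  \<comment> \<open>Two rows and \<open>2 * Suc k\<close> columns give the ratio
    \<open>k + 1\<close>, which is unbounded.\<close>
  have "(SUP k. ereal (real (2 * Suc k) / real (2 :: nat))) = \<infinity>"
  proof (rule SUP_PInfty)
    fix n :: nat
    show "\<exists>k\<in>UNIV. ereal (real n) \<le> ereal (real (2 * Suc k) / real (2 :: nat))"
      by (intro bexI[of _ n]) auto
  qed
  then show ?thesis
    using PInf by (intro exI[of _ "\<lambda>k. 2 * Suc k"] exI[of _ "\<lambda>_. 2"]) auto
next
  case MInf
  then show ?thesis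
    using assms by simp
qed

theorem theorem6p2:
  fixes \<alpha> :: ereal
  assumes "1 \<le> \<alpha>"
  shows "\<exists>S. boolean_sublattice S \<and> factorizable S \<and> S \<noteq> {{}} \<and> elasticity S = \<alpha>"
proof -
  obtain p q :: "nat \<Rightarrow> nat" where pq: "\<forall>k. 2 \<le> q k \<and> q k \<le> p k"
    and sup: "(SUP k. ereal (real (p k) / real (q k))) = \<alpha>"
    using ereal_eq_SUP_ratio[OF assms] by (elim exE conjE) (rule that)
  interpret disjoint_grids p q
    using pq by unfold_locales auto
  \<comment> \<open>As the lattice contains \<open>{}\<close>, this amounts to having at least two
    elements; any grid is a nonempty one.\<close>
  have "lattice \<noteq> {{}}"
    using grid_in_lattice by blast
  then show ?thesis
    using boolean_sublattice_lattice factorizable_lattice elasticity_lattice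
    unfolding sup by (intro exI[of _ lattice] conjI)
qed

end
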